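(* Let $K$ be a field, let $S=K[t_1,\ldots,t_s]$, $s\geq 2$, be a polynomial ring with the standard grading, and let $L$ be the ideal of $S$ generated by $t_2^{d_2},\ldots,t_s^{d_s}$, where $d_2,\ldots,d_s\geq 1$ are integers. If $t^a=t_1^{a_1}t_r^{a_r}\cdots t_s^{a_s}$ with $2\leq r\leq s$, all exponents nonnegative integers, $a_r\geq 1$, and $a_i\leq d_i-1$ for $i\geq r$, then $$ \deg(S/(L,t^a))=\deg(S/(L,t_r^{a_r}\cdots t_s^{a_s}))=d_2\cdots d_s-d_2\cdots d_{r-1}(d_r-a_r)\cdots(d_s-a_s), $$ where $a_i=0$ if $2\leq i<r$.
   Context: For a graded ideal $J$ of $S$ with $k=\dim(S/J)$ (Krull dimension) and $H_J(d)=\dim_K(S_d/J_d)$, the degree of $S/J$ is $\deg(S/J)=(k-1)!\lim_{d\to\infty}H_J(d)/d^{k-1}$ if $k\geq 1$, and $\deg(S/J)=\dim_K(S/J)$ if $k=0$. Empty products equal $1$. *)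

theory Defs
  imports Complex_Main "HOL-Library.Poly_Mapping" "HOL-Library.Extended_Nat" "HOL-Algebra.Algebra"
    "HOL-Algebra.Algebraic_Closure_Type"
begin

(* A monomial is its exponent vector "nat \<Rightarrow>\<^sub>0 nat"; a polynomial maps monomials to coefficients,
   and the multiplication that Poly_Mapping provides is the usual product of polynomials. *)
type_synonym 'k mpoly = "(nat \<Rightarrow>\<^sub>0 nat) \<Rightarrow>\<^sub>0 'k"

definition mvar :: "nat \<Rightarrow> 'k::field mpoly" where
  "mvar i = Poly_Mapping.single (Poly_Mapping.single i 1) 1"

definition const_poly :: "'k::field \<Rightarrow> 'k mpoly" where
  "const_poly c = Poly_Mapping.single 0 c"

(* K[t_1,...,t_s] *)
definition mpoly_ring :: "nat \<Rightarrow> 'k::field mpoly ring" where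
  "mpoly_ring s = ring_of_type_algebra
     \<lparr>carrier := {p. \<forall>m \<in> Poly_Mapping.keys p. Poly_Mapping.keys m \<subseteq> {1..s}}\<rparr>"

definition mon_degree :: "(nat \<Rightarrow>\<^sub>0 nat) \<Rightarrow> nat" where
  "mon_degree m = (\<Sum>i \<in> Poly_Mapping.keys m. Poly_Mapping.lookup m i)"

definition homog_comp :: "nat \<Rightarrow> nat \<Rightarrow> 'k::field mpoly set" where
  "homog_comp s n =
     {p \<in> carrier (mpoly_ring s). \<forall>m \<in> Poly_Mapping.keys p. mon_degree m = n}"

(* Dimension over K of the image in S/J of a K-subspace V of S. This image is V/(V \<inter> J).
   The field of scalars is the image of the constants in S/J. *)
definition quot_dim :: "nat \<Rightarrow> 'k::field mpoly set \<Rightarrow> 'k mpoly set \<Rightarrow> nat" where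
  "quot_dim s J V =
     (let S = mpoly_ring s; \<pi> = (\<lambda>p. J +>\<^bsub>S\<^esub> p)
      in ring.dim (S Quot J) (\<pi> ` range const_poly) (\<pi> ` V))"

definition hilbert_fun :: "nat \<Rightarrow> 'k::field mpoly set \<Rightarrow> nat \<Rightarrow> nat" where
  "hilbert_fun s J n = quot_dim s J (homog_comp s n)"

(* Supremum of the lengths n of chains P 0 \<subset> ... \<subset> P n of prime ideals. The zero ring gets 0;
   quot_degree then takes the value 0 on it. *)
definition krull_dim :: "('a, 'b) ring_scheme \<Rightarrow> enat" where
  "krull_dim R = Sup {enat n | n. \<exists>P :: nat \<Rightarrow> 'a set.
     (\<forall>i \<le> n. primeideal (P i) R) \<and> (\<forall>i < n. P i \<subset> P (Suc i))}"

(* deg(S/J) for a graded ideal J of S = K[t_1,...,t_s]; the Krull dimension of S/J is at most s,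
   so the_enat loses nothing. *)
definition quot_degree :: "nat \<Rightarrow> 'k::field mpoly set \<Rightarrow> real" where
  "quot_degree s J =
     (let k = the_enat (krull_dim (mpoly_ring s Quot J))
      in if k \<ge> 1
         then fact (k - 1) * lim (\<lambda>n. real (hilbert_fun s J n) / real n ^ (k - 1))
         else real (quot_dim s J (carrier (mpoly_ring s))))"

end

theory Submission
  imports Defs
begin

text \<open>The ideal \<open>J = (L, t\<^sup>a)\<close> is monomial, so it consists of the polynomials all of whose monomials
  are divisible by a generator, and the monomials divisible by no generator (the standard ones) form
  a basis of \<open>S/J\<close>. A prime containing \<open>J\<close> contains \<open>t\<^sub>2, \<dots>, t\<^sub>s\<close>, and \<open>J\<close> is contained in
  \<open>(t\<^sub>2, \<dots>, t\<^sub>s)\<close> because \<open>a\<^sub>r \<ge> 1\<close>; hence the Krull dimension of \<open>S/J\<close> is that of \<open>K[t\<^sub>1]\<close>,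
  namely 1, and the degree is the limit of the Hilbert function. A standard monomial of large degree
  \<open>n\<close> is determined by its exponents at \<open>t\<^sub>2, \<dots>, t\<^sub>s\<close>, which range over the box \<open>\<Prod>[0, d\<^sub>i)\<close> minus the
  corner where all exponents are at least \<open>a\<^sub>i\<close>; neither depends on \<open>n\<close> or on \<open>a\<^sub>1\<close>.\<close>

subsection \<open>The polynomial ring\<close>

lemma mpoly_ring_simps [simp]:
  "x \<otimes>\<^bsub>mpoly_ring s\<^esub> y = x * y" "x \<oplus>\<^bsub>mpoly_ring s\<^esub> y = x + y"
  "\<one>\<^bsub>mpoly_ring s\<^esub> = 1" "\<zero>\<^bsub>mpoly_ring s\<^esub> = 0"
  by (simp_all add: mpoly_ring_def ring_of_type_algebra_def)

lemma carrier_mpoly_ring: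
  "carrier (mpoly_ring s) = {p. \<forall>m \<in> Poly_Mapping.keys p. Poly_Mapping.keys m \<subseteq> {1..s}}"
  by (simp add: mpoly_ring_def)

lemma keys_add_nat:
  fixes m n :: "'a \<Rightarrow>\<^sub>0 nat"
  shows "Poly_Mapping.keys (m + n) = Poly_Mapping.keys m \<union> Poly_Mapping.keys n"
  by (auto simp: in_keys_iff lookup_add)

lemma keys_uminus [simp]: "Poly_Mapping.keys (- p :: 'a \<Rightarrow>\<^sub>0 'b::ab_group_add) = Poly_Mapping.keys p"
  by (auto simp: in_keys_iff)

lemma single_eq_0_iff [simp]: "Poly_Mapping.single k v = 0 \<longleftrightarrow> v = 0"
  by (metis lookup_single_eq lookup_zero single_zero)

lemma keys_diff_subset:
  "Poly_Mapping.keys (p - q :: 'a \<Rightarrow>\<^sub>0 'b::ab_group_add) \<subseteq> Poly_Mapping.keys p \<union> Poly_Mapping.keys q"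
  by (auto simp: in_keys_iff lookup_minus)

lemma mpoly_ring_closed [simp, intro]:
  "0 \<in> carrier (mpoly_ring s)" "1 \<in> carrier (mpoly_ring s)"
  "p \<in> carrier (mpoly_ring s) \<Longrightarrow> - p \<in> carrier (mpoly_ring s)"
  "p \<in> carrier (mpoly_ring s) \<Longrightarrow> q \<in> carrier (mpoly_ring s) \<Longrightarrow> p + q \<in> carrier (mpoly_ring s)"
  "p \<in> carrier (mpoly_ring s) \<Longrightarrow> q \<in> carrier (mpoly_ring s) \<Longrightarrow> p - q \<in> carrier (mpoly_ring s)"
  "p \<in> carrier (mpoly_ring s) \<Longrightarrow> q \<in> carrier (mpoly_ring s) \<Longrightarrow> p * q \<in> carrier (mpoly_ring s)"
  using keys_add[of p q] keys_diff_subset[of p q] keys_mult[of p q]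
  by (fastforce simp: carrier_mpoly_ring keys_add_nat)+

lemma cring_mpoly_ring: "cring (mpoly_ring s :: 'k::field mpoly ring)"
proof (rule cringI)
  show "abelian_group (mpoly_ring s :: 'k mpoly ring)"
    by (rule abelian_groupI) (auto simp: ac_simps intro: exI[of _ "- _"] bexI[of _ "- _"])
  show "comm_monoid (mpoly_ring s :: 'k mpoly ring)"
    by (rule comm_monoidI) (auto simp: ac_simps)
qed (simp add: distrib_right)

lemma ring_mpoly_ring: "ring (mpoly_ring s :: 'k::field mpoly ring)"
  using cring_mpoly_ring cring.axioms(1) by blast

lemma a_minus_mpoly_ring [simp]:
  assumes "p \<in> carrier (mpoly_ring s)" "q \<in> carrier (mpoly_ring s)"
  shows "p \<ominus>\<^bsub>mpoly_ring s\<^esub> q = p - (q :: 'k::field mpoly)"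
proof -
  interpret cring "mpoly_ring s :: 'k mpoly ring" by (rule cring_mpoly_ring)
  have "\<ominus>\<^bsub>mpoly_ring s\<^esub> q = - q"
    using assms by (intro minus_equality) auto
  then show ?thesis by (simp add: a_minus_def)
qed

lemma ideal_mpoly_ring_closed:
  fixes J :: "'k::field mpoly set"
  assumes "ideal J (mpoly_ring s)"
  shows "0 \<in> J" "p \<in> J \<Longrightarrow> p \<in> carrier (mpoly_ring s)"
    "p \<in> J \<Longrightarrow> q \<in> J \<Longrightarrow> p + q \<in> J" "p \<in> J \<Longrightarrow> - p \<in> J" "p \<in> J \<Longrightarrow> q \<in> J \<Longrightarrow> p - q \<in> J"
    "p \<in> carrier (mpoly_ring s) \<Longrightarrow> q \<in> J \<Longrightarrow> p * q \<in> J"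
proof -
  interpret ideal J "mpoly_ring s" by fact
  show "0 \<in> J" using additive_subgroup.zero_closed[OF is_additive_subgroup] by simp
  show carr: "p \<in> carrier (mpoly_ring s)" if "p \<in> J" for p using that by (rule a_Hcarr)
  show add: "p + q \<in> J" if "p \<in> J" "q \<in> J" for p q using additive_subgroup.a_closed[OF is_additive_subgroup that] by simp
  show mult: "p * q \<in> J" if "p \<in> carrier (mpoly_ring s)" "q \<in> J" for p q
    using I_l_closed[OF that(2,1)] by simp
  show minus: "- p \<in> J" if "p \<in> J" for p
    using mult[of "- 1" p] that by auto
  show "p - q \<in> J" if "p \<in> J" "q \<in> J" for p q
    using add[OF that(1) minus[OF that(2)]] by simp
qed

text \<open>Negation is multiplication by the ring element \<open>- 1\<close>, so closure under sums
  and multiples already yields an additive subgroup.\<close>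

lemma ideal_mpoly_ringI:
  fixes J :: "'k::field mpoly set"
  assumes "J \<subseteq> carrier (mpoly_ring s)" "0 \<in> J" "\<And>p q. p \<in> J \<Longrightarrow> q \<in> J \<Longrightarrow> p + q \<in> J"
    and mult: "\<And>p q. p \<in> carrier (mpoly_ring s) \<Longrightarrow> q \<in> J \<Longrightarrow> p * q \<in> J"
  shows "ideal J (mpoly_ring s)"
proof -
  interpret cring "mpoly_ring s :: 'k mpoly ring" by (rule cring_mpoly_ring)
  have minus: "- p \<in> J" if "p \<in> J" for p
    using mult[of "- 1" p] that by auto
  show ?thesis
  proof (rule idealI[OF ring_mpoly_ring])
    show "subgroup J (add_monoid (mpoly_ring s))"
    proof (rule add.subgroupI)
      fix p assume "p \<in> J"
      then have "\<ominus>\<^bsub>mpoly_ring s\<^esub> p = - p"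
        using assms(1) by (intro minus_equality) auto
      then show "\<ominus>\<^bsub>mpoly_ring s\<^esub> p \<in> J" using minus[OF \<open>p \<in> J\<close>] by (simp only:)
    qed (use assms in auto)
  next
    fix p q :: "'k mpoly" assume pq: "p \<in> J" "q \<in> carrier (mpoly_ring s)"
    show "q \<otimes>\<^bsub>mpoly_ring s\<^esub> p \<in> J" using mult[OF pq(2,1)] by simp
    show "p \<otimes>\<^bsub>mpoly_ring s\<^esub> q \<in> J" using mult[OF pq(2,1)] by (simp add: mult.commute)
  qed
qed

lemma poly_mapping_eq_sum_single:
  "p = (\<Sum>m \<in> Poly_Mapping.keys p. Poly_Mapping.single m (Poly_Mapping.lookup p m))"
  by (rule poly_mapping_eqI)
    (auto simp: lookup_sum lookup_single when_def sum.delta in_keys_iff)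

text \<open>The single-term case is restricted to exponents in the support of the fixed
  \<open>p\<close>, so that whatever is known about the monomials of \<open>p\<close> stays
  available during the induction.\<close>

lemma mpoly_ring_induct [consumes 1, case_names single zero add]:
  assumes p: "p \<in> carrier (mpoly_ring s)"
    and single: "\<And>m c. m \<in> Poly_Mapping.keys p \<Longrightarrow> P (Poly_Mapping.single m c)"
    and zero: "P 0" and add: "\<And>q r. P q \<Longrightarrow> P r \<Longrightarrow> P (q + r)"
  shows "P p"
proof -
  have "P (\<Sum>m \<in> M. Poly_Mapping.single m (Poly_Mapping.lookup p m))"
    if "finite M" "M \<subseteq> Poly_Mapping.keys p" for M
    using that by (induction M rule: finite_induct) (auto intro: single zero add)
  then show ?thesis
    using poly_mapping_eq_sum_single[of p] by (metis finite_keys order_refl)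
qed

lemma single_in_carrier_iff:
  "Poly_Mapping.single m c \<in> carrier (mpoly_ring s) \<longleftrightarrow> c = 0 \<or> Poly_Mapping.keys m \<subseteq> {1..s}"
  by (auto simp: carrier_mpoly_ring)

lemma const_poly_simps:
  "const_poly 0 = 0" "const_poly 1 = 1" "const_poly (c + d) = const_poly c + const_poly d"
  "const_poly (c * d) = const_poly c * const_poly d" "const_poly (- c) = - const_poly c"
  by (simp_all add: const_poly_def single_add mult_single single_uminus)

lemma const_poly_in_carrier [simp, intro]: "const_poly c \<in> carrier (mpoly_ring s)"
  by (simp add: const_poly_def single_in_carrier_iff)

subsection \<open>Monomial ideals\<close>

text \<open>Membership is tested monomial by monomial, which makes the standard monomials directly
  visible. \<open>genideal_monomials\<close> identifies this with the ideal generated by the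
  monomials with exponents in \<open>E\<close>, provided they only involve t_1, ..., t_s.\<close>

definition mon_ideal :: "nat \<Rightarrow> (nat \<Rightarrow>\<^sub>0 nat) set \<Rightarrow> 'k::field mpoly set" where
  "mon_ideal s E = {p \<in> carrier (mpoly_ring s). \<forall>m \<in> Poly_Mapping.keys p. \<exists>e \<in> E. \<exists>n. m = e + n}"

lemma single_in_ideal_of_divisor:
  fixes J :: "'k::field mpoly set"
  assumes J: "ideal J (mpoly_ring s)" and e: "Poly_Mapping.single e 1 \<in> J"
    and m: "Poly_Mapping.keys (e + n) \<subseteq> {1..s}"
  shows "Poly_Mapping.single (e + n) c \<in> J"
proof -
  have "Poly_Mapping.single n c \<in> carrier (mpoly_ring s)"
    using m by (auto simp: keys_add_nat single_in_carrier_iff)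
  from ideal_mpoly_ring_closed(6)[OF J this e] show ?thesis
    by (simp add: mult_single add.commute)
qed

lemma mon_ideal_subset:
  fixes J :: "'k::field mpoly set"
  assumes J: "ideal J (mpoly_ring s)" and E: "\<And>e. e \<in> E \<Longrightarrow> Poly_Mapping.single e 1 \<in> J"
  shows "mon_ideal s E \<subseteq> J"
proof
  fix p :: "'k mpoly" assume p: "p \<in> mon_ideal s E"
  then have "p \<in> carrier (mpoly_ring s)" by (simp add: mon_ideal_def)
  then show "p \<in> J"
  proof (induction rule: mpoly_ring_induct)
    case (single m c)
    with p obtain e n where "e \<in> E" "m = e + n" by (auto simp: mon_ideal_def)
    with single p show ?case
      using single_in_ideal_of_divisor[OF J E]
      by (auto simp: mon_ideal_def carrier_mpoly_ring)
  qed (use ideal_mpoly_ring_closed[OF J] in auto)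
qed

lemma mon_ideal_ideal: "ideal (mon_ideal s E) (mpoly_ring s)"
proof (rule ideal_mpoly_ringI)
  fix p q :: "'a mpoly"
  show "p + q \<in> mon_ideal s E" if "p \<in> mon_ideal s E" "q \<in> mon_ideal s E"
    using that keys_add[of p q] by (fastforce simp: mon_ideal_def)
  assume p: "p \<in> carrier (mpoly_ring s)" and q: "q \<in> mon_ideal s E"
  show "p * q \<in> mon_ideal s E"
    unfolding mon_ideal_def
  proof safe
    show "p * q \<in> carrier (mpoly_ring s)" using p q by (auto simp: mon_ideal_def)
    fix m assume "m \<in> Poly_Mapping.keys (p * q)"
    \<comment> \<open>A monomial of a product is a product of monomials of the factors; the one
      coming from \<open>q\<close> already has a divisor with exponent in \<open>E\<close>.\<close>
    then obtain k l where kl: "l \<in> Poly_Mapping.keys q" "m = k + l"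
      using keys_mult by blast
    then obtain e n where "e \<in> E" "l = e + n" using q by (auto simp: mon_ideal_def)
    with kl have "m = e + (k + n)" by (simp add: ac_simps)
    with \<open>e \<in> E\<close> show "\<exists>e \<in> E. \<exists>n. m = e + n" by blast
  qed
qed (auto simp: mon_ideal_def)

lemma single_in_mon_ideal:
  assumes "e \<in> E" "Poly_Mapping.keys e \<subseteq> {1..s}"
  shows "Poly_Mapping.single e c \<in> mon_ideal s E"
  using assms by (auto simp: mon_ideal_def single_in_carrier_iff intro!: bexI[of _ e] exI[of _ 0])

lemma genideal_monomials:
  assumes "\<And>e. e \<in> E \<Longrightarrow> Poly_Mapping.keys e \<subseteq> {1..s}"
  shows "genideal (mpoly_ring s) ((\<lambda>e. Poly_Mapping.single e 1) ` E) = (mon_ideal s E :: 'k::field mpoly set)"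
proof -
  interpret cring "mpoly_ring s :: 'k mpoly ring" by (rule cring_mpoly_ring)
  let ?G = "(\<lambda>e. Poly_Mapping.single e (1::'k)) ` E"
  have G: "?G \<subseteq> carrier (mpoly_ring s)"
    using assms by (auto simp: single_in_carrier_iff)
  show ?thesis
  proof
    show "genideal (mpoly_ring s) ?G \<subseteq> mon_ideal s E"
      by (rule genideal_minimal[OF mon_ideal_ideal], rule image_subsetI)
        (rule single_in_mon_ideal[OF _ assms])
    show "mon_ideal s E \<subseteq> genideal (mpoly_ring s) ?G"
      by (rule mon_ideal_subset[OF genideal_ideal[OF G]]) (use genideal_self[OF G] in auto)
  qed
qed

text \<open>Turns (L, t^a), where L is itself a generated ideal, into the ideal generated by one set
  of monomials, as \<open>genideal_monomials\<close> requires.\<close>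

lemma (in ring) genideal_genideal_Un:
  assumes "A \<subseteq> carrier R" "B \<subseteq> carrier R"
  shows "genideal R (genideal R A \<union> B) = genideal R (A \<union> B)"
proof
  have AB: "A \<union> B \<subseteq> carrier R" using assms by blast
  have "genideal R A \<subseteq> carrier R"
    using genideal_ideal[OF assms(1)] by (simp add: additive_subgroup.a_subset ideal.axioms(1))
  then have gAB: "genideal R A \<union> B \<subseteq> carrier R" using assms by blast
  have "genideal R A \<subseteq> genideal R (A \<union> B)"
    using genideal_self[OF AB] by (intro genideal_minimal[OF genideal_ideal[OF AB]]) blast
  then show "genideal R (genideal R A \<union> B) \<subseteq> genideal R (A \<union> B)"
    using genideal_self[OF AB] by (intro genideal_minimal[OF genideal_ideal[OF AB]]) blast
  show "genideal R (A \<union> B) \<subseteq> genideal R (genideal R A \<union> B)"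
    using genideal_self[OF gAB] genideal_self[OF assms(1)]
    by (intro genideal_minimal[OF genideal_ideal[OF gAB]]) blast
qed

lemma single_prod:
  "(\<Prod>i\<in>A. Poly_Mapping.single (f i) (1 :: 'k::field)) = Poly_Mapping.single (\<Sum>i\<in>A. f i) 1"
  for f :: "nat \<Rightarrow> nat \<Rightarrow>\<^sub>0 nat"
  by (induction A rule: infinite_finite_induct) (auto simp: mult_single)

lemma mvar_power: "mvar i ^ n = Poly_Mapping.single (Poly_Mapping.single i n) (1 :: 'k::field)"
  by (induction n) (auto simp: mvar_def mult_single simp flip: single_add)

subsection \<open>Hilbert functions of monomial ideals\<close>

text \<open>The constants are the image of a field under the ring homomorphism
  \<open>const_poly\<close> into a ring with 1 \<noteq> 0. They are the scalars for all dimensions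
  below.\<close>

lemma subfield_const_poly: "subfield (range const_poly) (mpoly_ring s :: 'k::field mpoly ring)"
proof -
  interpret K: field "ring_of_type_algebra :: 'k ring" by (rule field_from_type_algebra)
  have "const_poly \<in> ring_hom (ring_of_type_algebra :: 'k ring) (mpoly_ring s)"
    by (rule ring_hom_memI) (auto simp: ring_of_type_algebra_def const_poly_simps)
  then interpret ring_hom_ring "ring_of_type_algebra :: 'k ring" "mpoly_ring s" const_poly
    by (intro ring_hom_ringI2 ring_mpoly_ring) (rule K.ring_axioms)
  have "subfield (const_poly ` carrier (ring_of_type_algebra :: 'k ring)) (mpoly_ring s)"
    by (rule img_is_subfield(2)[OF K.carrier_is_subfield]) simp
  then show ?thesis by (simp add: ring_of_type_algebra_def)
qed

text \<open>Induction on \<open>M\<close>, adjoining one monomial at a time as a new basis vector.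
  Independence modulo \<open>J\<close> holds because no element of \<open>J\<close> has a monomial
  of \<open>M\<close> in its support.\<close>

lemma dimension_image_monomials:
  fixes J :: "'k::field mpoly set" and s :: nat
  defines "S \<equiv> mpoly_ring s"
  defines "\<pi> \<equiv> (\<lambda>p. J +>\<^bsub>S\<^esub> p)"
  assumes J: "ideal J S" and "finite M" and M: "\<And>m. m \<in> M \<Longrightarrow> Poly_Mapping.keys m \<subseteq> {1..s}"
    and indep: "\<And>p m. p \<in> J \<Longrightarrow> m \<in> M \<Longrightarrow> m \<notin> Poly_Mapping.keys p"
  shows "ring.dimension (S Quot J) (card M) (\<pi> ` range const_poly) (\<pi> ` {p. Poly_Mapping.keys p \<subseteq> M})"
proof -
  interpret S: cring S unfolding S_def by (rule cring_mpoly_ring)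
  interpret J: ideal J S by fact
  interpret Q: ring "S Quot J" by (rule J.quotient_is_ring)
  interpret \<pi>: ring_hom_ring S "S Quot J" \<pi> unfolding \<pi>_def by (rule J.rcos_ring_hom_ring)
  have \<pi>_eq: "\<pi> p = \<pi> q \<longleftrightarrow> p - q \<in> J" if "p \<in> carrier S" "q \<in> carrier S" for p q
    using S.quotient_eq_iff_same_a_r_cos[OF J that] that unfolding \<pi>_def S_def by simp
  have \<pi>_add: "\<pi> p \<oplus>\<^bsub>S Quot J\<^esub> \<pi> q = \<pi> (p + q)" if "p \<in> carrier S" "q \<in> carrier S" for p q
    using \<pi>.hom_add[OF that] by (simp add: S_def)
  have \<pi>_mult: "\<pi> p \<otimes>\<^bsub>S Quot J\<^esub> \<pi> q = \<pi> (p * q)" if "p \<in> carrier S" "q \<in> carrier S" for p q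
    using \<pi>.hom_mult[OF that] by (simp add: S_def)
  show ?thesis
    using \<open>finite M\<close> M indep
  proof (induction M rule: finite_induct)
    case empty
    have "{p :: 'k mpoly. Poly_Mapping.keys p \<subseteq> {}} = {0}" by auto
    moreover have "\<pi> 0 = \<zero>\<^bsub>S Quot J\<^esub>" using \<pi>.hom_zero by (simp add: S_def)
    ultimately show ?case by simp
  next
    case (insert m M)
    let ?K = "\<pi> ` range const_poly"
    let ?V = "\<lambda>M. {p :: 'k mpoly. Poly_Mapping.keys p \<subseteq> M}"
    have V: "p \<in> carrier S" if "p \<in> ?V (insert m M)" for p
      using that insert.prems(1) unfolding S_def carrier_mpoly_ring by blast
    have m: "Poly_Mapping.single m c \<in> carrier S" for c :: 'k
      using V[of "Poly_Mapping.single m c"] by simp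
    have const_m: "const_poly c * Poly_Mapping.single m 1 = Poly_Mapping.single m c" for c :: 'k
      by (simp add: const_poly_def mult_single)
    have const: "const_poly c \<in> carrier S" for c :: 'k
      by (simp add: S_def)
    \<comment> \<open>A polynomial \<open>p\<close> over \<open>M\<close> has coefficient 0 at
      \<open>m\<close>; if it were congruent to the monomial \<open>m\<close>, then \<open>m\<close>
      would occur in an element of \<open>J\<close>.\<close>
    have "\<pi> (Poly_Mapping.single m 1) \<notin> \<pi> ` ?V M"
    proof
      assume "\<pi> (Poly_Mapping.single m 1) \<in> \<pi> ` ?V M"
      then obtain p where p: "p \<in> ?V M" "\<pi> (Poly_Mapping.single m 1) = \<pi> p" by blast
      then have "Poly_Mapping.single m 1 - p \<in> J"
        using \<pi>_eq[of "Poly_Mapping.single m 1" p] m V[of p] by auto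
      moreover have "Poly_Mapping.lookup p m = 0"
        using p(1) insert.hyps by (auto simp: in_keys_iff)
      ultimately show False
        using insert.prems(2)[of "Poly_Mapping.single m 1 - p" m]
        by (simp add: in_keys_iff lookup_minus)
    qed
    moreover have "\<pi> (Poly_Mapping.single m 1) \<in> carrier (S Quot J)"
      by (rule \<pi>.hom_closed[OF m])
    moreover have "Q.dimension (card M) ?K (\<pi> ` ?V M)"
      using insert.prems by (intro insert.IH) auto
    ultimately have "Q.dimension (Suc (card M)) ?K
        (Q.line_extension ?K (\<pi> (Poly_Mapping.single m 1)) (\<pi> ` ?V M))"
      by (intro Q.Suc_dim)
    moreover have "Q.line_extension ?K (\<pi> (Poly_Mapping.single m 1)) (\<pi> ` ?V M) = \<pi> ` ?V (insert m M)"
    proof (intro equalityI subsetI)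
      fix u assume "u \<in> Q.line_extension ?K (\<pi> (Poly_Mapping.single m 1)) (\<pi> ` ?V M)"
      then obtain c p where cp: "p \<in> ?V M"
        "u = \<pi> (const_poly c) \<otimes>\<^bsub>S Quot J\<^esub> \<pi> (Poly_Mapping.single m 1) \<oplus>\<^bsub>S Quot J\<^esub> \<pi> p"
        unfolding Q.line_extension_mem_iff by blast
      have "p \<in> carrier S" using cp(1) by (intro V) auto
      then have "u = \<pi> (Poly_Mapping.single m c + p)"
        using cp m const by (simp add: \<pi>_mult \<pi>_add const_m)
      moreover have "Poly_Mapping.single m c + p \<in> ?V (insert m M)"
        using cp(1) keys_add[of "Poly_Mapping.single m c" p] by (auto split: if_splits)
      ultimately show "u \<in> \<pi> ` ?V (insert m M)" by blast
    next
      fix u assume "u \<in> \<pi> ` ?V (insert m M)"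
      then obtain p where p: "p \<in> ?V (insert m M)" "u = \<pi> p" by blast
      define c where "c = Poly_Mapping.lookup p m"
      define q where "q = p - Poly_Mapping.single m c"
      have q: "q \<in> ?V M"
        using p(1) by (auto simp: q_def c_def in_keys_iff lookup_minus lookup_single when_def
            split: if_splits)
      have "q \<in> carrier S" using q by (intro V) auto
      then have "u = \<pi> (const_poly c) \<otimes>\<^bsub>S Quot J\<^esub> \<pi> (Poly_Mapping.single m 1) \<oplus>\<^bsub>S Quot J\<^esub> \<pi> q"
        using p m const by (simp add: \<pi>_mult \<pi>_add const_m) (simp add: q_def)
      with q show "u \<in> Q.line_extension ?K (\<pi> (Poly_Mapping.single m 1)) (\<pi> ` ?V M)"
        unfolding Q.line_extension_mem_iff by blast
    qed
    ultimately show ?case using insert.hyps by simp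
  qed
qed

text \<open>Modulo a monomial ideal a form is congruent to its standard part, and the standard
  monomials are independent since none of them occurs in a member of the ideal. The condition
  \<open>0 \<notin> E\<close> keeps the quotient nonzero, so that the images of the constants form a
  subfield and the dimension is unique.\<close>

lemma hilbert_fun_mon_ideal:
  fixes E :: "(nat \<Rightarrow>\<^sub>0 nat) set" and s :: nat
  defines "M \<equiv> (\<lambda>n. {m. Poly_Mapping.keys m \<subseteq> {1..s} \<and> mon_degree m = n \<and> \<not> (\<exists>e \<in> E. \<exists>l. m = e + l)})"
  assumes "0 \<notin> E" and fin: "finite (M n)"
  shows "hilbert_fun s (mon_ideal s E :: 'k::field mpoly set) n = card (M n)"
proof -
  define S where "S = (mpoly_ring s :: 'k mpoly ring)"
  define J where "J = (mon_ideal s E :: 'k mpoly set)"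
  define \<pi> where "\<pi> = (\<lambda>p. J +>\<^bsub>S\<^esub> p)"
  have J: "ideal J S" unfolding S_def J_def by (rule mon_ideal_ideal)
  interpret S: cring S unfolding S_def by (rule cring_mpoly_ring)
  interpret J: ideal J S by fact
  interpret Q: ring "S Quot J" by (rule J.quotient_is_ring)
  interpret \<pi>: ring_hom_ring S "S Quot J" \<pi> unfolding \<pi>_def by (rule J.rcos_ring_hom_ring)
  have \<pi>_eq: "\<pi> p = \<pi> q \<longleftrightarrow> p - q \<in> J" if "p \<in> carrier S" "q \<in> carrier S" for p q
    using S.quotient_eq_iff_same_a_r_cos[OF J that] that unfolding \<pi>_def S_def by simp
  have "1 \<notin> J"
  proof
    assume "1 \<in> J"
    then obtain e n where "e \<in> E" "0 = e + n" by (auto simp: J_def mon_ideal_def)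
    then have "Poly_Mapping.keys e = {}" using keys_add_nat[of e n] by simp
    then show False using \<open>e \<in> E\<close> \<open>0 \<notin> E\<close> by simp
  qed
  then have one_zero: "\<one>\<^bsub>S Quot J\<^esub> \<noteq> \<zero>\<^bsub>S Quot J\<^esub>"
    using \<pi>_eq[of 1 0] \<pi>.hom_one \<pi>.hom_zero by (auto simp: S_def)
  have "Q.dimension (card (M n)) (\<pi> ` range const_poly) (\<pi> ` {p. Poly_Mapping.keys p \<subseteq> M n})"
    unfolding \<pi>_def S_def
    by (rule dimension_image_monomials) (use J fin in \<open>auto simp: S_def J_def M_def mon_ideal_def\<close>)
  moreover have "\<pi> ` {p. Poly_Mapping.keys p \<subseteq> M n} = \<pi> ` homog_comp s n"
  proof (rule equalityI, goal_cases)
    case 1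
    show ?case
      by (rule image_mono) (auto simp: M_def homog_comp_def carrier_mpoly_ring)
  next
    case 2
    show ?case
    proof
      fix u assume "u \<in> \<pi> ` homog_comp s n"
      then obtain p where p: "p \<in> homog_comp s n" "u = \<pi> p" by blast
      \<comment> \<open>\<open>q\<close> keeps the standard terms of \<open>p\<close>; the dropped
        terms are divisible by generators, so \<open>p - q\<close> lies in \<open>J\<close>.\<close>
      define q where "q = (\<Sum>m \<in> Poly_Mapping.keys p \<inter> M n. Poly_Mapping.single m (Poly_Mapping.lookup p m))"
      have lookup_q: "Poly_Mapping.lookup q m = (if m \<in> M n then Poly_Mapping.lookup p m else 0)" for m
        by (auto simp: q_def lookup_sum lookup_single when_def in_keys_iff)
      have "Poly_Mapping.keys q \<subseteq> M n" by (auto simp: in_keys_iff lookup_q split: if_splits)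
      moreover have p_carr: "p \<in> carrier S" and q_carr: "q \<in> carrier S"
        using p(1) by (auto simp: homog_comp_def S_def carrier_mpoly_ring in_keys_iff lookup_q split: if_splits)
      moreover have "p - q \<in> J"
        unfolding J_def mon_ideal_def
      proof (intro CollectI conjI ballI)
        show "p - q \<in> carrier (mpoly_ring s)" using p_carr q_carr by (auto simp: S_def)
        fix m assume "m \<in> Poly_Mapping.keys (p - q)"
        then have m: "m \<in> Poly_Mapping.keys p" "m \<notin> M n"
          by (auto simp: in_keys_iff lookup_minus lookup_q split: if_splits)
        have "Poly_Mapping.keys m \<subseteq> {1..s}" "mon_degree m = n"
          using p(1) m(1) unfolding homog_comp_def carrier_mpoly_ring by blast+
        then show "\<exists>e \<in> E. \<exists>l. m = e + l" using m(2) unfolding M_def by blast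
      qed
      ultimately show "u \<in> \<pi> ` {p. Poly_Mapping.keys p \<subseteq> M n}"
        using p(2) \<pi>_eq[of p q] by blast
    qed
  qed
  moreover have "subfield (\<pi> ` range const_poly) (S Quot J)"
    by (rule \<pi>.img_is_subfield(2)[OF _ one_zero]) (simp add: S_def subfield_const_poly)
  ultimately have "(Q.dim over (\<pi> ` range const_poly)) (\<pi> ` homog_comp s n) = card (M n)"
    by (intro Q.dimI) auto
  then show ?thesis
    by (simp add: hilbert_fun_def quot_dim_def Let_def over_def S_def J_def \<pi>_def)
qed

subsection \<open>Krull dimension\<close>

lemma primeideal_mpoly_ringI:
  fixes P :: "'k::field mpoly set"
  assumes "ideal P (mpoly_ring s)" "1 \<notin> P"
    and "\<And>p q. p \<in> carrier (mpoly_ring s) \<Longrightarrow> q \<in> carrier (mpoly_ring s) \<Longrightarrow> p * q \<in> P \<Longrightarrow> p \<in> P \<or> q \<in> P"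
  shows "primeideal P (mpoly_ring s)"
proof (rule primeidealI)
  show "carrier (mpoly_ring s) \<noteq> P" using assms(2) by blast
qed (use assms cring_mpoly_ring in auto)

section \<open>Setting variables to zero, and the primes generated by variables\<close>

text \<open>The substitution of 0 for all variables outside \<open>T\<close>, given by its effect on
  the support.\<close>

definition restrict_vars :: "nat set \<Rightarrow> 'k::field mpoly \<Rightarrow> 'k mpoly" where
  "restrict_vars T p =
     (\<Sum>m \<in> {m \<in> Poly_Mapping.keys p. Poly_Mapping.keys m \<subseteq> T}. Poly_Mapping.single m (Poly_Mapping.lookup p m))"

lemma lookup_restrict_vars:
  "Poly_Mapping.lookup (restrict_vars T p) m = (if Poly_Mapping.keys m \<subseteq> T then Poly_Mapping.lookup p m else 0)"
  by (auto simp: restrict_vars_def lookup_sum lookup_single when_def in_keys_iff)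

lemma restrict_vars_add: "restrict_vars T (p + q) = restrict_vars T p + restrict_vars T q"
  by (rule poly_mapping_eqI) (simp add: lookup_restrict_vars lookup_add)

lemma restrict_vars_eq_0: "restrict_vars T p = 0 \<longleftrightarrow> (\<forall>m \<in> Poly_Mapping.keys p. \<not> Poly_Mapping.keys m \<subseteq> T)"
  by (auto simp: poly_mapping_eq_iff fun_eq_iff lookup_restrict_vars in_keys_iff)

lemma restrict_vars_idem: "(\<And>m. m \<in> Poly_Mapping.keys p \<Longrightarrow> Poly_Mapping.keys m \<subseteq> T) \<Longrightarrow> restrict_vars T p = p"
  by (rule poly_mapping_eqI) (auto simp: lookup_restrict_vars in_keys_iff)

text \<open>Each factor is split into a surviving part and a killed part. A killed monomial stays
  killed in any product because exponents only grow, and a product of surviving parts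
  survives.\<close>

lemma restrict_vars_mult: "restrict_vars T (p * q) = restrict_vars T p * restrict_vars T q"
proof -
  have outside: "restrict_vars T (u * v) = 0" if "restrict_vars T u = 0" for u v :: "'a mpoly"
    unfolding restrict_vars_eq_0
  proof
    fix m assume "m \<in> Poly_Mapping.keys (u * v)"
    then obtain k l where "k \<in> Poly_Mapping.keys u" "m = k + l" using keys_mult by blast
    with that show "\<not> Poly_Mapping.keys m \<subseteq> T" by (auto simp: restrict_vars_eq_0 keys_add_nat)
  qed
  define p' q' where "p' = p - restrict_vars T p" and "q' = q - restrict_vars T q"
  have "restrict_vars T p' = 0" "restrict_vars T q' = 0"
    by (auto simp: p'_def q'_def restrict_vars_eq_0 in_keys_iff lookup_minus lookup_restrict_vars)
  then have zero: "restrict_vars T (p' * q) = 0" "restrict_vars T (q' * restrict_vars T p) = 0"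
    by (auto intro: outside)
  have "p * q = restrict_vars T p * restrict_vars T q + q' * restrict_vars T p + p' * q"
    by (simp add: p'_def q'_def algebra_simps)
  then have "restrict_vars T (p * q) = restrict_vars T (restrict_vars T p * restrict_vars T q)"
    by (simp only: restrict_vars_add zero add_0_right)
  also have "\<dots> = restrict_vars T p * restrict_vars T q"
  proof (rule restrict_vars_idem)
    fix m assume "m \<in> Poly_Mapping.keys (restrict_vars T p * restrict_vars T q)"
    then obtain k l where "k \<in> Poly_Mapping.keys (restrict_vars T p)"
      "l \<in> Poly_Mapping.keys (restrict_vars T q)" "m = k + l" using keys_mult by blast
    then show "Poly_Mapping.keys m \<subseteq> T"
      by (auto simp: keys_add_nat in_keys_iff lookup_restrict_vars split: if_splits)
  qed
  finally show ?thesis .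
qed

text \<open>The ideal generated by the variables outside \<open>T\<close>, described as the kernel of
  setting these variables to zero.\<close>

definition var_ideal :: "nat \<Rightarrow> nat set \<Rightarrow> 'k::field mpoly set" where
  "var_ideal s T = {p \<in> carrier (mpoly_ring s). restrict_vars T p = 0}"

text \<open>Setting variables to zero is a ring homomorphism into a domain, and the kernel of such a
  map is prime.\<close>

lemma primeideal_var_ideal: "primeideal (var_ideal s T :: 'k::field mpoly set) (mpoly_ring s)"
proof (rule primeideal_mpoly_ringI)
  show "ideal (var_ideal s T :: 'k mpoly set) (mpoly_ring s)"
  proof (rule ideal_mpoly_ringI)
    show "0 \<in> (var_ideal s T :: 'k mpoly set)"
      by (simp add: var_ideal_def restrict_vars_eq_0)
  qed (auto simp: var_ideal_def restrict_vars_add restrict_vars_mult)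
next
  show "1 \<notin> (var_ideal s T :: 'k mpoly set)"
    by (simp add: var_ideal_def restrict_vars_eq_0)
next
  fix p q :: "'k mpoly"
  assume "p \<in> carrier (mpoly_ring s)" "q \<in> carrier (mpoly_ring s)" "p * q \<in> var_ideal s T"
  then show "p \<in> var_ideal s T \<or> q \<in> var_ideal s T"
    by (simp add: var_ideal_def restrict_vars_mult)
qed

section \<open>Ideals of K[x]\<close>

text \<open>A nonzero element of least degree generates, since the remainder on division by it stays
  in \<open>I\<close> and would have smaller degree if it were nonzero. For the zero ideal the
  generator is 0.\<close>

lemma poly_ideal_principal:
  fixes I :: "'a::field poly set"
  assumes "0 \<in> I" and add: "\<And>p q. p \<in> I \<Longrightarrow> q \<in> I \<Longrightarrow> p + q \<in> I"
    and mult: "\<And>p q. q \<in> I \<Longrightarrow> p * q \<in> I"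
  obtains g where "g \<in> I" "\<And>p. p \<in> I \<Longrightarrow> g dvd p"
proof (cases "I = {0}")
  case False
  then obtain p0 where p0: "p0 \<in> I - {0}" using \<open>0 \<in> I\<close> by blast
  define g where "g = arg_min Polynomial.degree (\<lambda>p. p \<in> I - {0})"
  have g: "g \<in> I - {0}"
    unfolding g_def by (rule arg_min_natI[where P = "\<lambda>p. p \<in> I - {0}", OF p0])
  have least: "Polynomial.degree g \<le> Polynomial.degree p" if "p \<in> I - {0}" for p
    unfolding g_def by (rule arg_min_nat_le[where P = "\<lambda>p. p \<in> I - {0}", OF that])
  show ?thesis
  proof (rule that)
    show "g \<in> I" using g by blast
    fix p assume "p \<in> I"
    have "p mod g = p + (- (p div g)) * g"
      by (simp add: minus_div_mult_eq_mod)
    then have "p mod g \<in> I" using add[OF \<open>p \<in> I\<close> mult[of g]] g by (metis DiffD1)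
    moreover have "\<not> Polynomial.degree g \<le> Polynomial.degree (p mod g)" if "p mod g \<noteq> 0"
      using degree_mod_less'[of g p] g that by auto
    ultimately have "p mod g = 0" using least by blast
    then show "g dvd p" by (simp add: dvd_eq_mod_eq_0)
  qed
qed (use that in auto)

text \<open>A nonzero prime of a PID is maximal.\<close>

lemma poly_prime_chain:
  fixes I1 I2 :: "'a::field poly set"
  assumes "0 \<in> I1" and "\<And>p q. p \<in> I1 \<Longrightarrow> q \<in> I1 \<Longrightarrow> p + q \<in> I1" and "\<And>p q. q \<in> I1 \<Longrightarrow> p * q \<in> I1"
    and "0 \<in> I2" and "\<And>p q. p \<in> I2 \<Longrightarrow> q \<in> I2 \<Longrightarrow> p + q \<in> I2" and mult2: "\<And>p q. q \<in> I2 \<Longrightarrow> p * q \<in> I2"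
    and prime: "\<And>p q. p * q \<in> I1 \<Longrightarrow> p \<in> I1 \<or> q \<in> I1"
    and "I1 \<noteq> {0}" and "I1 \<subset> I2"
  shows "1 \<in> I2"
proof -
  obtain f where f: "f \<in> I1" "\<And>p. p \<in> I1 \<Longrightarrow> f dvd p"
    using poly_ideal_principal[OF assms(1-3)] by blast
  obtain g where g: "g \<in> I2" "\<And>p. p \<in> I2 \<Longrightarrow> g dvd p"
    using poly_ideal_principal[OF assms(4-6)] by blast
  have "f \<noteq> 0" using f(2) \<open>I1 \<noteq> {0}\<close> \<open>0 \<in> I1\<close> by auto
  have "f \<in> I2" using f(1) \<open>I1 \<subset> I2\<close> by blast
  then obtain h where h: "f = g * h" using g(2) by (metis dvdE)
  have "g \<notin> I1"
  proof
    assume "g \<in> I1"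
    have "I2 \<subseteq> I1"
    proof
      fix p assume "p \<in> I2"
      then obtain k where "p = k * g" using g(2) by (metis dvdE mult.commute)
      then show "p \<in> I1" using assms(3) \<open>g \<in> I1\<close> by simp
    qed
    then show False using \<open>I1 \<subset> I2\<close> by blast
  qed
  \<comment> \<open>Primality forces the cofactor \<open>h\<close> into \<open>I1\<close>, so
    \<open>f\<close> divides \<open>h\<close> while \<open>f = g * h\<close>; cancelling
    \<open>f\<close> makes \<open>g\<close> a unit.\<close>
  then have "h \<in> I1" using prime f(1) h by blast
  then obtain k where "h = f * k" using f(2) by (metis dvdE)
  then have "f * (k * g) = f * 1" using h by (simp add: mult_ac)
  then have "k * g = 1" using \<open>f \<noteq> 0\<close> by (metis mult_left_cancel)
  then show "1 \<in> I2" using mult2[OF g(1), of k] by simp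
qed

section \<open>Reduction of prime chains to K[x]\<close>

text \<open>Evaluation at t_1, a homomorphism along which ideals of S are contracted to ideals of
  the Euclidean ring \<open>'k poly\<close>.\<close>

definition univariate :: "'k::field poly \<Rightarrow> 'k mpoly" where
  "univariate u = poly (map_poly const_poly u) (mvar 1)"

lemma univariate_0: "univariate 0 = 0"
  by (simp add: univariate_def)

lemma univariate_pCons: "univariate (pCons c u) = const_poly c + mvar 1 * univariate u"
  by (simp add: univariate_def map_poly_pCons const_poly_simps)

lemma univariate_add: "univariate (u + v) = univariate u + univariate v"
  by (induction u v rule: poly_induct2)
    (simp_all add: univariate_0 univariate_pCons const_poly_simps algebra_simps)

lemma univariate_smult: "univariate (smult c u) = const_poly c * univariate u"
  by (induction u) (simp_all add: univariate_0 univariate_pCons const_poly_simps algebra_simps)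

lemma univariate_mult: "univariate (u * v) = univariate u * univariate v"
  by (induction u)
    (simp_all add: univariate_0 univariate_pCons univariate_add univariate_smult
      const_poly_simps algebra_simps)

lemma univariate_1: "univariate 1 = 1"
  by (simp add: one_pCons univariate_0 univariate_pCons const_poly_simps)

lemma univariate_monom: "univariate (monom c n) = Poly_Mapping.single (Poly_Mapping.single 1 n) c"
  by (induction n)
    (simp_all add: monom_0 monom_Suc univariate_0 univariate_pCons const_poly_def mvar_def mult_single
      flip: single_add)

lemma univariate_in_carrier: "1 \<le> s \<Longrightarrow> univariate u \<in> carrier (mpoly_ring s)"
  by (induction u) (auto simp: univariate_0 univariate_pCons mvar_def single_in_carrier_iff
      intro!: mpoly_ring_closed)

text \<open>A monomial involving some t_i with i \<ge> 2 lies in \<open>P\<close>; all others are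
  powers of t_1, hence univariate.\<close>

lemma congruent_univariate:
  fixes P :: "'k::field mpoly set"
  assumes P: "ideal P (mpoly_ring s)" and vars: "\<And>i. i \<in> {2..s} \<Longrightarrow> mvar i \<in> P"
    and p: "p \<in> carrier (mpoly_ring s)"
  shows "\<exists>u. p - univariate u \<in> P"
  using p
proof (induction rule: mpoly_ring_induct)
  case (single m c)
  then have m: "Poly_Mapping.keys m \<subseteq> {1..s}" using p by (simp add: carrier_mpoly_ring)
  show ?case
  proof (cases "Poly_Mapping.keys m \<subseteq> {1}")
    case True
    then have "m = Poly_Mapping.single 1 (Poly_Mapping.lookup m 1)"
      by (intro poly_mapping_eqI) (auto simp: lookup_single when_def in_keys_iff)
    then show ?thesis
      using univariate_monom[of c "Poly_Mapping.lookup m 1"] ideal_mpoly_ring_closed(1)[OF P]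
      by (metis diff_self)
  next
    case False
    then obtain i where i: "i \<in> Poly_Mapping.keys m" "i \<in> {2..s}"
      using m by (fastforce simp: subset_iff)
    \<comment> \<open>The exponent at \<open>i\<close> is positive, so the truncated subtraction is
      exact and t_i divides the monomial.\<close>
    define l where "l = m - Poly_Mapping.single i 1"
    have "m = Poly_Mapping.single i 1 + l"
      using i(1) by (intro poly_mapping_eqI)
        (auto simp: l_def lookup_add lookup_minus lookup_single when_def in_keys_iff)
    then have "Poly_Mapping.single m c \<in> P"
      using single_in_ideal_of_divisor[OF P, of "Poly_Mapping.single i 1" l c] vars[OF i(2)] m
      by (simp add: mvar_def)
    then show ?thesis by (metis diff_zero univariate_0)
  qed
next
  case (add q r)
  then obtain u v where "q - univariate u \<in> P" "r - univariate v \<in> P" by blast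
  from ideal_mpoly_ring_closed(3)[OF P this]
  have "q + r - univariate (u + v) \<in> P" by (simp add: univariate_add algebra_simps)
  then show ?case by blast
next
  case zero
  show ?case using ideal_mpoly_ring_closed(1)[OF P] by (metis diff_self univariate_0)
qed

text \<open>With t_2, ..., t_s in \<open>A\<close>, every polynomial is univariate modulo
  \<open>A\<close>, so the chain contracts to K[x] without losing strictness. There \<open>B\<close>
  becomes a nonzero prime properly below the contraction of \<open>C\<close>, which forces 1 into
  \<open>C\<close>.\<close>

lemma no_prime_chain:
  fixes A B C :: "'k::field mpoly set"
  assumes "1 \<le> s" and A: "primeideal A (mpoly_ring s)" and B: "primeideal B (mpoly_ring s)"
    and C: "primeideal C (mpoly_ring s)"
    and vars: "\<And>i. i \<in> {2..s} \<Longrightarrow> mvar i \<in> A" and AB: "A \<subset> B" and BC: "B \<subset> C"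
  shows False
proof -
  have ideals: "ideal A (mpoly_ring s)" "ideal B (mpoly_ring s)" "ideal C (mpoly_ring s)"
    using A B C by (auto intro: primeideal.axioms(1))
  note closed = ideal_mpoly_ring_closed
  note carr = univariate_in_carrier[OF \<open>1 \<le> s\<close>]
  \<comment> \<open>An element of \<open>Q\<close> outside \<open>P\<close> can be replaced by its
    univariate representative, as the two differ by an element of \<open>A\<close>, which lies in
    both ideals.\<close>
  have strict: "\<exists>u. univariate u \<in> Q \<and> univariate u \<notin> P"
    if PQ: "P \<subset> Q" "A \<subseteq> P" and ideal_PQ: "ideal P (mpoly_ring s)" "ideal Q (mpoly_ring s)" for P Q
  proof -
    obtain p where p: "p \<in> Q" "p \<notin> P" using PQ(1) by blast
    obtain u where u: "p - univariate u \<in> A"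
      using congruent_univariate[OF ideals(1) vars closed(2)[OF ideal_PQ(2) p(1)]] by blast
    have "p - (p - univariate u) \<in> Q" using closed(5)[OF ideal_PQ(2) p(1), of "p - univariate u"] u PQ by blast
    moreover have "univariate u \<notin> P"
    proof
      assume "univariate u \<in> P"
      from closed(3)[OF ideal_PQ(1) _ this, of "p - univariate u"] u p(2) \<open>A \<subseteq> P\<close> show False by auto
    qed
    ultimately show ?thesis by auto
  qed
  have "1 \<in> univariate -` C"
  proof (rule poly_prime_chain[of "univariate -` B"])
    \<comment> \<open>Strictness of \<open>A \<subset> B\<close> makes the contraction of
      \<open>B\<close> nonzero: the univariate witness avoids \<open>A\<close>, which contains
      0.\<close>
    show "univariate -` B \<noteq> {0}"
    proof -
      obtain u where "univariate u \<in> B" "univariate u \<notin> A"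
        using strict[OF AB order_refl ideals(1,2)] by blast
      moreover from this have "u \<noteq> 0"
        using closed(1)[OF ideals(1)] by (auto simp: univariate_0)
      ultimately show ?thesis by blast
    qed
    show "univariate -` B \<subset> univariate -` C"
      using strict[OF BC psubset_imp_subset[OF AB] ideals(2,3)] BC by blast
    show "p \<in> univariate -` B \<or> q \<in> univariate -` B" if "p * q \<in> univariate -` B" for p q
      using primeideal.I_prime[OF B carr[of p] carr[of q]] that by (simp add: univariate_mult)
  qed (auto simp: univariate_0 univariate_add univariate_mult
      intro: closed[OF ideals(2)] closed[OF ideals(3)] carr)
  then have "p \<in> C" if "p \<in> carrier (mpoly_ring s)" for p
    using closed(6)[OF ideals(3) that, of 1] by (simp add: univariate_1)
  then have "carrier (mpoly_ring s) = C" using closed(2)[OF ideals(3)] by blast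
  then show False using primeideal.I_notcarr[OF C] by blast
qed

section \<open>Primes of a quotient ring and the dimension of S/J\<close>

lemma (in ideal) primeideal_vimage_quotient:
  assumes "cring R" and P: "primeideal P (R Quot I)"
  shows "primeideal {x \<in> carrier R. I +> x \<in> P} R"
proof -
  interpret R: cring R by fact
  interpret Q: cring "R Quot I" by (rule quotient_is_cring[OF assms(1)])
  interpret \<pi>: ring_hom_ring R "R Quot I" "(+>) I" by (rule rcos_ring_hom_ring)
  show ?thesis
  proof (rule primeidealI)
    show "ideal {x \<in> carrier R. I +> x \<in> P} R"
      by (rule \<pi>.ideal_vimage[OF primeideal.axioms(1)[OF P]])
    show "carrier R \<noteq> {x \<in> carrier R. I +> x \<in> P}"
    proof
      assume "carrier R = {x \<in> carrier R. I +> x \<in> P}"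
      then have "\<one> \<in> {x \<in> carrier R. I +> x \<in> P}" using one_closed by blast
      then have "\<one>\<^bsub>R Quot I\<^esub> \<in> P" by simp
      then show False
        using primeideal.I_notcarr[OF P] ideal.one_imp_carrier[OF primeideal.axioms(1)[OF P]] by blast
    qed
    show "a \<in> {x \<in> carrier R. I +> x \<in> P} \<or> b \<in> {x \<in> carrier R. I +> x \<in> P}"
      if "a \<in> carrier R" "b \<in> carrier R" "a \<otimes> b \<in> {x \<in> carrier R. I +> x \<in> P}" for a b
      using that primeideal.I_prime[OF P, of "I +> a" "I +> b"] by auto
  qed (fact assms(1))
qed

text \<open>Since \<open>I \<subseteq> P\<close>, membership in \<open>P\<close> does not depend on
  the representative of a coset; this equivalence carries properness and primality over to the
  quotient.\<close>

lemma (in ideal) primeideal_image_quotient: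
  assumes "cring R" and P: "primeideal P R" and IP: "I \<subseteq> P"
  shows "primeideal ((+>) I ` P) (R Quot I)"
    and "\<And>x. x \<in> carrier R \<Longrightarrow> I +> x \<in> (+>) I ` P \<longleftrightarrow> x \<in> P"
proof -
  interpret R: cring R by fact
  interpret Q: cring "R Quot I" by (rule quotient_is_cring[OF assms(1)])
  interpret P: primeideal P R by fact
  interpret \<pi>: ring_hom_ring R "R Quot I" "(+>) I" by (rule rcos_ring_hom_ring)
  show mem: "I +> x \<in> (+>) I ` P \<longleftrightarrow> x \<in> P" if x: "x \<in> carrier R" for x
  proof
    assume "I +> x \<in> (+>) I ` P"
    then obtain y where y: "y \<in> P" "I +> x = I +> y" by blast
    have y_carr: "y \<in> carrier R" using y(1) by (rule P.Icarr)
    have "x \<ominus> y \<in> P"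
      using quotient_eq_iff_same_a_r_cos[OF is_ideal x y_carr] y(2) IP by blast
    then have "(x \<ominus> y) \<oplus> y \<in> P" using y(1) P.a_closed by blast
    then show "x \<in> P" using x y_carr by (simp add: minus_eq a_assoc l_neg)
  qed blast
  show "primeideal ((+>) I ` P) (R Quot I)"
  proof (rule primeidealI)
    show "ideal ((+>) I ` P) (R Quot I)"
      by (rule ring_ideal_imp_quot_ideal[OF is_ideal P.is_ideal])
    have "\<one> \<notin> P" using P.I_notcarr P.one_imp_carrier by blast
    then show "carrier (R Quot I) \<noteq> (+>) I ` P"
      using mem[OF one_closed] \<pi>.hom_closed[OF one_closed] by metis
    fix a b assume "a \<in> carrier (R Quot I)" "b \<in> carrier (R Quot I)"
      and ab: "a \<otimes>\<^bsub>R Quot I\<^esub> b \<in> (+>) I ` P"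
    then obtain x y where xy: "x \<in> carrier R" "a = I +> x" "y \<in> carrier R" "b = I +> y"
      unfolding FactRing_def A_RCOSETS_def' by auto
    then have "I +> (x \<otimes> y) \<in> (+>) I ` P" using ab by simp
    then have "x \<otimes> y \<in> P" using mem[of "x \<otimes> y"] xy by blast
    then show "a \<in> (+>) I ` P \<or> b \<in> (+>) I ` P" using P.I_prime xy by blast
  qed (rule Q.is_cring)
qed

text \<open>Upper bound: three nested primes of the quotient contract to primes of S containing
  powers of t_2, ..., t_s, hence these variables themselves, and \<open>no_prime_chain\<close>
  applies. Lower bound: (t_2, ..., t_s) and (t_1, ..., t_s) both contain \<open>J\<close> and have
  distinct prime images in the quotient.\<close>

lemma krull_dim_eq_1:
  fixes J :: "'k::field mpoly set"
  assumes "1 \<le> s" and J: "ideal J (mpoly_ring s)"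
    and pow: "\<And>i. i \<in> {2..s} \<Longrightarrow> \<exists>n. mvar i ^ n \<in> J"
    and J_sub: "J \<subseteq> var_ideal s {1}"
  shows "krull_dim (mpoly_ring s Quot J) = 1"
proof -
  define S where "S = (mpoly_ring s :: 'k mpoly ring)"
  interpret S: cring S unfolding S_def by (rule cring_mpoly_ring)
  interpret J: ideal J S unfolding S_def by fact
  let ?lengths = "{enat n | n. \<exists>P :: nat \<Rightarrow> 'k mpoly set set.
     (\<forall>i \<le> n. primeideal (P i) (S Quot J)) \<and> (\<forall>i < n. P i \<subset> P (Suc i))}"
  have "l \<le> 1" if "l \<in> ?lengths" for l
  proof (rule ccontr)
    assume "\<not> l \<le> 1"
    from that obtain n P where l: "l = enat n"
      and P: "\<And>i. i \<le> n \<Longrightarrow> primeideal (P i) (S Quot J)" "\<And>i. i < n \<Longrightarrow> P i \<subset> P (Suc i)"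
      by blast
    \<comment> \<open>Length at least 2 provides three primes; only \<open>P 0\<close>,
      \<open>P 1\<close> and \<open>P 2\<close> enter the contradiction.\<close>
    have n: "n \<ge> 2" using \<open>\<not> l \<le> 1\<close> by (simp add: l one_enat_def)
    define A where "A i = {x \<in> carrier S. J +>\<^bsub>S\<^esub> x \<in> P i}" for i
    have A: "primeideal (A i) (mpoly_ring s)" if "i \<le> 2" for i
      using J.primeideal_vimage_quotient[OF S.is_cring P(1)[of i]] that n
      by (simp add: A_def S_def)
    have A_strict: "A i \<subset> A (Suc i)" if "i < 2" for i
    proof -
      have sub: "P i \<subset> P (Suc i)" and prime: "primeideal (P (Suc i)) (S Quot J)"
        using P n that by auto
      obtain y where y: "y \<in> P (Suc i)" "y \<notin> P i" using sub by blast
      have "y \<in> carrier (S Quot J)"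
        using primeideal.axioms(1)[OF prime] y(1) by (rule ideal.Icarr)
      then obtain x where "x \<in> carrier S" "y = J +>\<^bsub>S\<^esub> x"
        unfolding FactRing_def A_RCOSETS_def' by auto
      then show ?thesis using sub y unfolding A_def by blast
    qed
    have "mvar i \<in> A 0" if i: "i \<in> {2..s}" for i
    proof -
      obtain k where k: "mvar i ^ k \<in> J" using pow[OF i] by blast
      have "ideal (P 0) (S Quot J)" using P(1)[of 0] by (simp add: primeideal.axioms(1))
      then have "\<zero>\<^bsub>S Quot J\<^esub> \<in> P 0"
        by (simp add: additive_subgroup.zero_closed ideal.axioms(1))
      moreover have "J +>\<^bsub>S\<^esub> (mvar i ^ k) = \<zero>\<^bsub>S Quot J\<^esub>"
        using J.a_rcos_const[OF k] by (simp add: FactRing_def)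
      ultimately have pow_mem: "mvar i ^ k \<in> A 0"
        using k J.Icarr by (simp add: A_def)
      have mvar_carr: "mvar i ^ j \<in> carrier (mpoly_ring s)" for j
        using i by (simp add: mvar_power single_in_carrier_iff)
      \<comment> \<open>A prime contains the base of any power it contains; exponent 0 is
        impossible, as it would put 1 into the prime.\<close>
      show ?thesis using pow_mem
      proof (induction k)
        case 0
        then show ?case
          using primeideal.I_notcarr[OF A[of 0]] ideal.one_imp_carrier[OF primeideal.axioms(1)[OF A[of 0]]]
          by simp
      next
        case (Suc k)
        then show ?case
          using primeideal.I_prime[OF A[of 0], of "mvar i" "mvar i ^ k"] mvar_carr[of 1] mvar_carr[of k]
          by auto
      qed
    qed
    then show False
      using no_prime_chain[OF \<open>1 \<le> s\<close> A[of 0] A[of 1] A[of 2]] A_strict[of 0] A_strict[of 1]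
      by (simp add: numeral_2_eq_2)
  qed
  moreover have "1 \<in> ?lengths"
  proof -
    \<comment> \<open>Index 0 keeps t_1 and gives the image of (t_2, ..., t_s); later indices keep
      no variable and give the image of (t_1, ..., t_s).\<close>
    define P where "P i = (+>\<^bsub>S\<^esub>) J ` var_ideal s (if i = 0 then {1} else {})" for i :: nat
    have mono: "var_ideal s {1} \<subseteq> (var_ideal s {} :: 'k mpoly set)"
      by (auto simp: var_ideal_def restrict_vars_eq_0)
    have sub: "J \<subseteq> var_ideal s (if i = 0 then {1} else {})" for i :: nat
      using J_sub mono by auto
    have "primeideal (var_ideal s T) S" for T
      unfolding S_def by (rule primeideal_var_ideal)
    note img = J.primeideal_image_quotient[OF S.is_cring this sub]
    have "primeideal (P i) (S Quot J)" for i
      unfolding P_def by (rule img(1))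
    moreover have "P 0 \<subset> P (Suc 0)"
    proof -
      have "mvar 1 \<in> carrier S" using \<open>1 \<le> s\<close> by (simp add: S_def mvar_def single_in_carrier_iff)
      moreover from this have "(mvar 1 :: 'k mpoly) \<notin> var_ideal s {1}" "(mvar 1 :: 'k mpoly) \<in> var_ideal s {}"
        by (auto simp: S_def var_ideal_def restrict_vars_eq_0 mvar_def)
      ultimately have "J +>\<^bsub>S\<^esub> mvar 1 \<in> P (Suc 0) - P 0"
        using img(2)[of "mvar 1" 0] img(2)[of "mvar 1" 1] by (simp add: P_def)
      then show ?thesis using mono unfolding P_def by auto
    qed
    ultimately have "(\<forall>i \<le> 1. primeideal (P i) (S Quot J)) \<and> (\<forall>i < 1. P i \<subset> P (Suc i))"
      by simp
    then have "enat 1 \<in> ?lengths" by blast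
    then show ?thesis by (simp add: one_enat_def)
  qed
  ultimately have "Sup ?lengths = 1"
    by (intro cSup_eq_maximum)
  then show ?thesis by (simp add: krull_dim_def S_def)
qed

subsection \<open>Counting the standard monomials\<close>

lemma divides_iff_lookup_le:
  fixes e m :: "'a \<Rightarrow>\<^sub>0 nat"
  shows "(\<exists>l. m = e + l) \<longleftrightarrow> (\<forall>i. Poly_Mapping.lookup e i \<le> Poly_Mapping.lookup m i)"
proof
  assume le: "\<forall>i. Poly_Mapping.lookup e i \<le> Poly_Mapping.lookup m i"
  have "m = e + (m - e)"
    using le by (intro poly_mapping_eqI) (simp add: lookup_add lookup_minus)
  then show "\<exists>l. m = e + l" by blast
qed (auto simp: lookup_add)

lemma lookup_sum_singles:
  "finite A \<Longrightarrow> Poly_Mapping.lookup (\<Sum>i\<in>A. Poly_Mapping.single i (c i)) j = (if j \<in> A then c j else 0)"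
  by (auto simp: lookup_sum lookup_single when_def)

lemma mon_degree_eq_sum:
  assumes "finite A" "Poly_Mapping.keys m \<subseteq> A"
  shows "mon_degree m = (\<Sum>i\<in>A. Poly_Mapping.lookup m i)"
  unfolding mon_degree_def
  by (rule sum.mono_neutral_left) (use assms in \<open>auto simp: in_keys_iff\<close>)

lemma sum_split_first: "1 \<le> s \<Longrightarrow> (\<Sum>i = 1..s. f i) = f 1 + (\<Sum>i = 2..s. f i)"
  for f :: "nat \<Rightarrow> nat"
  by (simp add: sum.atLeast_Suc_atMost numeral_2_eq_2)

text \<open>In degree \<open>n\<close> the exponent of \<open>t\<^sub>1\<close> is determined by the other exponents, and for large
  \<open>n\<close> it is so big that it no longer matters for divisibility.\<close>

lemma bij_betw_forget_first_exponent:
  fixes s n :: nat and d :: "nat \<Rightarrow> nat" and Q :: "(nat \<Rightarrow> nat) \<Rightarrow> bool"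
  assumes "1 \<le> s" and n: "b + (\<Sum>i = 2..s. d i) \<le> n"
    and Q: "\<And>f g. (\<And>i. i \<in> {2..s} \<Longrightarrow> f i = g i) \<Longrightarrow> Q f = Q g"
  shows "bij_betw (\<lambda>m. restrict (Poly_Mapping.lookup m) {2..s})
    {m. Poly_Mapping.keys m \<subseteq> {1..s} \<and> mon_degree m = n \<and>
      (\<forall>i \<in> {2..s}. Poly_Mapping.lookup m i < d i) \<and>
      \<not> (b \<le> Poly_Mapping.lookup m 1 \<and> Q (Poly_Mapping.lookup m))}
    {f \<in> (\<Pi>\<^sub>E i \<in> {2..s}. {..<d i}). \<not> Q f}"
    (is "bij_betw ?h ?M ?X")
proof -
  \<comment> \<open>The inverse map: t_1 receives the degree still missing from \<open>n\<close>.
    The subtraction is exact on the box, where the other exponents sum to at most the sum of the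
    \<open>d i\<close>, hence to at most \<open>n\<close>.\<close>
  define g where "g f = (\<Sum>i = 1..s. Poly_Mapping.single i
    (if i = 1 then n - (\<Sum>j = 2..s. f j) else f i))" for f :: "nat \<Rightarrow> nat"
  have lookup_g: "Poly_Mapping.lookup (g f) i =
      (if i = 1 then n - (\<Sum>j = 2..s. f j) else if i \<in> {2..s} then f i else 0)" for f i
    using \<open>1 \<le> s\<close> unfolding g_def by (auto simp: lookup_sum_singles)
  have keys_g: "Poly_Mapping.keys (g f) \<subseteq> {1..s}" for f
    using \<open>1 \<le> s\<close> by (auto simp: in_keys_iff lookup_g split: if_splits)
  have degree: "mon_degree m = Poly_Mapping.lookup m 1 + (\<Sum>i = 2..s. Poly_Mapping.lookup m i)"
    if "Poly_Mapping.keys m \<subseteq> {1..s}" for m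
    using mon_degree_eq_sum[OF _ that] sum_split_first[OF \<open>1 \<le> s\<close>, of "Poly_Mapping.lookup m"] by simp
  have sum_le: "(\<Sum>i = 2..s. f i) \<le> (\<Sum>i = 2..s. d i)" if "\<forall>i \<in> {2..s}. f i < d i" for f :: "nat \<Rightarrow> nat"
    using that by (intro sum_mono) (simp add: less_imp_le)
  show ?thesis
  proof (rule bij_betw_byWitness[where f' = g])
    show "\<forall>m \<in> ?M. g (?h m) = m"
    proof
      fix m assume m: "m \<in> ?M"
      show "g (?h m) = m"
      proof (rule poly_mapping_eqI)
        fix i
        have "Poly_Mapping.lookup m i = 0" if "i \<noteq> 1" "i \<notin> {2..s}"
        proof -
          have "i \<notin> {1..s}" using that by auto
          then have "i \<notin> Poly_Mapping.keys m" using m by blast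
          then show ?thesis by (simp add: in_keys_iff)
        qed
        moreover have "n - (\<Sum>j = 2..s. Poly_Mapping.lookup m j) = Poly_Mapping.lookup m 1"
          using m degree[of m] by simp
        ultimately show "Poly_Mapping.lookup (g (?h m)) i = Poly_Mapping.lookup m i"
          by (auto simp: lookup_g)
      qed
    qed
    show "\<forall>f \<in> ?X. ?h (g f) = f"
    proof
      fix f assume "f \<in> ?X"
      then have f: "f \<in> extensional {2..s}" by (auto simp: PiE_def)
      show "?h (g f) = f"
        by (rule extensionalityI[OF restrict_extensional f]) (simp add: lookup_g)
    qed
    show "?h ` ?M \<subseteq> ?X"
    proof
      fix f assume "f \<in> ?h ` ?M"
      then obtain m where m: "m \<in> ?M" "f = ?h m" by blast
      \<comment> \<open>The other exponents use at most the sum of the \<open>d i\<close>, so the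
        bound on \<open>n\<close> leaves at least \<open>b\<close> for t_1 and the excluded
        condition reduces to \<open>Q\<close>.\<close>
      then have "b \<le> Poly_Mapping.lookup m 1"
        using degree[of m] sum_le[of "Poly_Mapping.lookup m"] n by simp
      moreover have "Q f = Q (Poly_Mapping.lookup m)"
        using m(2) by (intro Q) simp
      ultimately show "f \<in> ?X" using m by (simp add: PiE_def Pi_def)
    qed
    show "g ` ?X \<subseteq> ?M"
    proof
      fix m assume "m \<in> g ` ?X"
      then obtain f where f: "f \<in> ?X" "m = g f" by blast
      then have lt: "\<forall>i \<in> {2..s}. f i < d i" by (auto simp: PiE_def Pi_def)
      then have le: "(\<Sum>i = 2..s. f i) \<le> n" using sum_le n by fastforce
      have "(\<Sum>i = 2..s. Poly_Mapping.lookup m i) = (\<Sum>i = 2..s. f i)"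
        using f(2) by (intro sum.cong) (auto simp: lookup_g)
      then have "mon_degree m = n"
        using degree[of m] keys_g[of f] f(2) le by (simp add: lookup_g)
      moreover have "Q (Poly_Mapping.lookup m) = Q f"
        using f(2) by (intro Q) (simp add: lookup_g)
      ultimately show "m \<in> ?M"
        using f lt keys_g[of f] by (simp add: lookup_g)
    qed
  qed
qed

text \<open>Complementary counting: the excluded points form a subbox with sides \<open>d i\<close>
  below \<open>r\<close> and \<open>d i - a i\<close> from \<open>r\<close> on. The bound
  \<open>a i \<le> d i\<close> makes natural and real subtraction agree.\<close>

lemma card_box_minus_corner:
  fixes a d :: "nat \<Rightarrow> nat"
  assumes "2 \<le> r" "r \<le> s" and a: "\<And>i. i \<in> {r..s} \<Longrightarrow> a i \<le> d i"
  shows "real (card {f \<in> (\<Pi>\<^sub>E i \<in> {2..s}. {..<d i}). \<not> (\<forall>i \<in> {r..s}. a i \<le> f i)})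
    = (\<Prod>i = 2..s. real (d i)) - (\<Prod>i = 2..<r. real (d i)) * (\<Prod>i = r..s. (real (d i) - real (a i)))"
proof -
  let ?box = "\<Pi>\<^sub>E i \<in> {2..s}. {..<d i}"
  let ?corner = "\<Pi>\<^sub>E i \<in> {2..s}. if i < r then {..<d i} else {a i..<d i}"
  have sub: "?corner \<subseteq> ?box" by (intro PiE_mono) auto
  have "{f \<in> ?box. \<not> (\<forall>i \<in> {r..s}. a i \<le> f i)} = ?box - ?corner"
    using assms(1,2) by (fastforce simp: PiE_iff split: if_splits)
  moreover have "finite ?box" by (intro finite_PiE) auto
  ultimately have "real (card {f \<in> ?box. \<not> (\<forall>i \<in> {r..s}. a i \<le> f i)}) = real (card ?box) - real (card ?corner)"
    using sub by (simp add: card_Diff_subset finite_subset card_mono of_nat_diff)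
  moreover have "real (card ?box) = (\<Prod>i = 2..s. real (d i))"
    by (simp add: card_PiE)
  moreover have "real (card ?corner) = (\<Prod>i = 2..<r. real (d i)) * (\<Prod>i = r..s. (real (d i) - real (a i)))"
  proof -
    have "{2..s} = {2..<r} \<union> {r..s}" using assms(1,2) by auto
    then have "real (card ?corner) = (\<Prod>i \<in> {2..<r} \<union> {r..s}. real (if i < r then d i else d i - a i))"
      by (simp add: card_PiE if_distrib cong: if_cong)
    also have "\<dots> = (\<Prod>i = 2..<r. real (if i < r then d i else d i - a i)) *
        (\<Prod>i = r..s. real (if i < r then d i else d i - a i))"
      by (rule prod.union_disjoint) auto
    also have "\<dots> = (\<Prod>i = 2..<r. real (d i)) * (\<Prod>i = r..s. (real (d i) - real (a i)))"
      using a by (intro arg_cong2[where f = "(*)"] prod.cong) (auto simp: of_nat_diff)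
    finally show ?thesis .
  qed
  ultimately show ?thesis by simp
qed

section \<open>Computation of the degree\<close>

text \<open>In dimension 1 the normalisation is trivial, as 0! = 1 and n^0 = 1, so the degree is the
  limit of an eventually constant sequence.\<close>

lemma quot_degree_of_dim_1:
  assumes "krull_dim (mpoly_ring s Quot J) = 1"
    and "\<And>n. n \<ge> N \<Longrightarrow> hilbert_fun s J n = c"
  shows "quot_degree s J = real c"
proof -
  have "(\<lambda>n. real (hilbert_fun s J n)) \<longlonglongrightarrow> real c"
    by (rule tendsto_eventually) (use assms(2) in \<open>auto simp: eventually_sequentially\<close>)
  then show ?thesis
    using assms(1) by (simp add: quot_degree_def one_enat_def limI)
qed

text \<open>The exponent \<open>b\<close> of t_1 is arbitrary and absent from the value, so one
  computation serves both ideals of the theorem.\<close>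

lemma quot_degree_powers_and_monomial:
  fixes s r :: nat and d a :: "nat \<Rightarrow> nat" and L :: "'k::field mpoly set"
  assumes "s \<ge> 2"
    and d: "\<And>i. i \<in> {2..s} \<Longrightarrow> d i \<ge> 1"
    and L: "L = genideal (mpoly_ring s) {mvar i ^ d i | i. i \<in> {2..s}}"
    and r: "2 \<le> r" "r \<le> s"
    and "a r \<ge> 1"
    and a: "\<And>i. i \<in> {r..s} \<Longrightarrow> a i \<le> d i"
  shows "quot_degree s (genideal (mpoly_ring s) (L \<union> {mvar 1 ^ b * (\<Prod>i = r..s. mvar i ^ a i)}))
           = (\<Prod>i = 2..s. real (d i)) - (\<Prod>i = 2..<r. real (d i)) * (\<Prod>i = r..s. (real (d i) - real (a i)))"
proof -
  \<comment> \<open>\<open>w\<close> is the exponent vector of the extra monomial, and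
    \<open>E\<close> collects the exponent vectors of all generators.\<close>
  define w where "w = Poly_Mapping.single 1 b + (\<Sum>i = r..s. Poly_Mapping.single i (a i))"
  define E where "E = insert w ((\<lambda>i. Poly_Mapping.single i (d i)) ` {2..s})"
  define J where "J = genideal (mpoly_ring s) (L \<union> {mvar 1 ^ b * (\<Prod>i = r..s. mvar i ^ a i)})"
  have lookup_w: "Poly_Mapping.lookup w i = (if i = 1 then b else if i \<in> {r..s} then a i else 0)" for i
    using r(1) by (auto simp: w_def lookup_add lookup_single lookup_sum_singles when_def)
  have w_monomial: "mvar 1 ^ b * (\<Prod>i = r..s. mvar i ^ a i) = Poly_Mapping.single w (1 :: 'k)"
    by (simp add: mvar_power single_prod mult_single w_def)
  have keys_E: "Poly_Mapping.keys e \<subseteq> {1..s}" if "e \<in> E" for e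
    using that r by (auto simp: E_def in_keys_iff lookup_w lookup_single when_def split: if_splits)
  have J_eq: "J = mon_ideal s E"
  proof -
    interpret cring "mpoly_ring s :: 'k mpoly ring" by (rule cring_mpoly_ring)
    let ?P = "{mvar i ^ d i :: 'k mpoly | i. i \<in> {2..s}}"
    have gens: "?P \<union> {Poly_Mapping.single w (1 :: 'k)} = (\<lambda>e. Poly_Mapping.single e 1) ` E"
      by (auto simp: E_def mvar_power)
    have "?P \<union> {Poly_Mapping.single w (1 :: 'k)} \<subseteq> carrier (mpoly_ring s)"
      unfolding gens using keys_E by (auto simp: single_in_carrier_iff)
    then have "J = genideal (mpoly_ring s) (?P \<union> {Poly_Mapping.single w 1})"
      unfolding J_def L w_monomial by (intro genideal_genideal_Un) blast+
    also have "\<dots> = mon_ideal s E"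
      unfolding gens by (rule genideal_monomials) (rule keys_E)
    finally show ?thesis .
  qed
  have "0 \<notin> E"
  proof -
    have "Poly_Mapping.lookup w r \<noteq> 0" using r \<open>a r \<ge> 1\<close> by (simp add: lookup_w)
    then show ?thesis using d by (fastforce simp: E_def dest: arg_cong[where f = Poly_Mapping.keys])
  qed
  have dim: "krull_dim (mpoly_ring s Quot J) = 1"
  proof (rule krull_dim_eq_1)
    show "ideal J (mpoly_ring s)" unfolding J_eq by (rule mon_ideal_ideal)
    show "\<exists>n. mvar i ^ n \<in> J" if "i \<in> {2..s}" for i
      using single_in_mon_ideal[OF _ keys_E, of "Poly_Mapping.single i (d i)" E 1] that
      unfolding J_eq by (auto simp: E_def mvar_power intro!: exI[of _ "d i"])
    show "J \<subseteq> var_ideal s {1}"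
    proof
      fix p assume p: "p \<in> J"
      \<comment> \<open>Every generator involves a variable other than t_1: the extra monomial
        contains t_r because \<open>a r \<ge> 1\<close>, and each power of t_i is nontrivial because
        \<open>d i \<ge> 1\<close>.\<close>
      have "\<not> Poly_Mapping.keys e \<subseteq> {1}" if "e \<in> E" for e
      proof -
        have "r \<in> Poly_Mapping.keys w" using r \<open>a r \<ge> 1\<close> by (simp add: in_keys_iff lookup_w)
        then show ?thesis using that r d by (fastforce simp: E_def)
      qed
      then show "p \<in> var_ideal s {1}"
        using p by (fastforce simp: J_eq mon_ideal_def var_ideal_def restrict_vars_eq_0 keys_add_nat)
    qed
  qed (use \<open>s \<ge> 2\<close> in simp)
  let ?M = "\<lambda>n. {m. Poly_Mapping.keys m \<subseteq> {1..s} \<and> mon_degree m = n \<and> \<not> (\<exists>e \<in> E. \<exists>l. m = e + l)}"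
  let ?Q = "\<lambda>f :: nat \<Rightarrow> nat. \<forall>i \<in> {r..s}. a i \<le> f i"
  let ?X = "{f \<in> (\<Pi>\<^sub>E i \<in> {2..s}. {..<d i}). \<not> ?Q f}"
  \<comment> \<open>The powers bound each exponent separately, while \<open>w\<close> gives one
    condition on t_1 and one on t_r, ..., t_s. This is the form in which the first exponent can be
    forgotten, with \<open>?Q\<close> as the condition on the rest.\<close>
  have divisible: "(\<exists>e \<in> E. \<exists>l. m = e + l) \<longleftrightarrow>
      (\<exists>i \<in> {2..s}. d i \<le> Poly_Mapping.lookup m i) \<or>
      b \<le> Poly_Mapping.lookup m 1 \<and> ?Q (Poly_Mapping.lookup m)" for m
    using r by (auto simp: E_def divides_iff_lookup_le lookup_w lookup_single when_def)
  have "hilbert_fun s J n = card ?X" if "n \<ge> b + (\<Sum>i = 2..s. d i)" for n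
  proof -
    have "?M n = {m. Poly_Mapping.keys m \<subseteq> {1..s} \<and> mon_degree m = n \<and>
      (\<forall>i \<in> {2..s}. Poly_Mapping.lookup m i < d i) \<and>
      \<not> (b \<le> Poly_Mapping.lookup m 1 \<and> ?Q (Poly_Mapping.lookup m))}"
      unfolding divisible by (auto simp: not_le)
    then have bij: "bij_betw (\<lambda>m. restrict (Poly_Mapping.lookup m) {2..s}) (?M n) ?X"
      using bij_betw_forget_first_exponent[of s b d n ?Q] \<open>s \<ge> 2\<close> r that by auto
    have "finite ?X" by (rule finite_subset[of _ "\<Pi>\<^sub>E i \<in> {2..s}. {..<d i}"]) (auto intro: finite_PiE)
    then have "finite (?M n)" using bij_betw_finite[OF bij] by blast
    from hilbert_fun_mon_ideal[OF \<open>0 \<notin> E\<close> this] show ?thesis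
      unfolding J_eq using bij_betw_same_card[OF bij] by simp
  qed
  from quot_degree_of_dim_1[OF dim this] card_box_minus_corner[OF r a] show ?thesis
    unfolding J_def by simp
qed

theorem lemma3p3:
  fixes s r :: nat and d a :: "nat \<Rightarrow> nat" and L :: "'k::field mpoly set"
  assumes "s \<ge> 2"
    and "\<And>i. i \<in> {2..s} \<Longrightarrow> d i \<ge> 1"
    and "L = genideal (mpoly_ring s) {mvar i ^ d i | i. i \<in> {2..s}}"
    and "2 \<le> r" and "r \<le> s"
    and "a r \<ge> 1"
    and "\<And>i. i \<in> {r..s} \<Longrightarrow> a i \<le> d i - 1"
  shows "quot_degree s (genideal (mpoly_ring s) (L \<union> {mvar 1 ^ a 1 * (\<Prod>i = r..s. mvar i ^ a i)}))
           = quot_degree s (genideal (mpoly_ring s) (L \<union> {\<Prod>i = r..s. mvar i ^ a i}))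
       \<and> quot_degree s (genideal (mpoly_ring s) (L \<union> {\<Prod>i = r..s. mvar i ^ a i}))
           = (\<Prod>i = 2..s. real (d i)) - (\<Prod>i = 2..<r. real (d i)) * (\<Prod>i = r..s. (real (d i) - real (a i)))"
proof -
  have "a i \<le> d i" if "i \<in> {r..s}" for i
    using assms(7)[OF that] by simp
  note degree = quot_degree_powers_and_monomial[OF assms(1-6) this]
  \<comment> \<open>Taking \<open>b = a 1\<close> gives the first ideal; \<open>b = 0\<close> gives
    the second, since the factor \<open>mvar 1 ^ 0\<close> is 1.\<close>
  show ?thesis using degree[of "a 1"] degree[of 0] by simp
qed

end
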